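(* Let $f:\mathbb{R}\to\mathbb{R}$ be locally Lipschitz continuous, increasing and odd, with $f(0)=0$ and $xf(x)>0$ for all $x\neq 0$. Suppose that there exists $\epsilon_0\in(0,1)$ such that for every $\epsilon\in(0,\epsilon_0)$ $$\underline{\Phi}_f(\epsilon):=\liminf_{x\to 0^+}\frac{f((1-\epsilon)x)}{f(x)}>0,\qquad\text{and}\quad \underline{\Phi}_f(\epsilon)\to 1\ \text{ as } \epsilon\to 0^+,$$ and that $$\limsup_{x\to 0^+}\frac{f(\mu x)}{f(x)}<\mu\quad\text{for all }\mu\in(0,1).$$ Let $g:[0,\infty)\to\mathbb{R}$ be continuous, let $\xi\in\mathbb{R}$, and let $x$ be the continuous solution on $[0,\infty)$ of $x'(t)=-f(x(t))+g(t)$, $t>0$, $x(0)=\xi$. Suppose that $x(t)\to 0$ as $t\to\infty$. Then the following statements are equivalent: (a) $\lim_{t\to\infty}\int_0^t g(s)\,ds$ exists (and is finite), and $$\lim_{t\to\infty}\frac{\int_t^\infty g(s)\,ds}{F^{-1}(t)}=0;$$ (b) there is $\lambda\in\{-1,0,1\}$ such that $$\lim_{t\to\infty}\frac{x(t)}{F^{-1}(t)}=\lambda.$$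
   Context: $F:(0,\infty)\to\mathbb{R}$ is defined by $F(x)=\int_x^1 \frac{1}{f(u)}\,du$. It is strictly decreasing, and $F^{-1}$ denotes its inverse function. Under the stated hypotheses $F(x)\to+\infty$ as $x\to0^+$, so $F^{-1}(t)$ is defined for all $t\ge 0$. The integral $\int_t^\infty g(s)\,ds$ is understood as the improper integral $\lim_{T\to\infty}\int_t^T g(s)\,ds$. *)

theory Defs
  imports "HOL-Analysis.Analysis"
begin

text \<open>The liminf is taken in \<^typ>\<open>ereal\<close>, where it always exists.\<close>

definition Phi_lower :: "(real \<Rightarrow> real) \<Rightarrow> real \<Rightarrow> ereal" where
  "Phi_lower f \<epsilon> = Liminf (at_right 0) (\<lambda>x. ereal (f ((1 - \<epsilon>) * x) / f x))"

text \<open>The interval integral is oriented, so \<open>F_fun f x\<close> is negative for \<open>x > 1\<close>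
  when \<open>f\<close> is positive on \<open>(0, \<infinity>)\<close>.  Only arguments \<open>x > 0\<close> are meaningful.\<close>

definition F_fun :: "(real \<Rightarrow> real) \<Rightarrow> real \<Rightarrow> real" where
  "F_fun f x = (LBINT u=x..1. 1 / f u)"

definition F_inv :: "(real \<Rightarrow> real) \<Rightarrow> real \<Rightarrow> real" where
  "F_inv f = inv_into {0<..} (F_fun f)"

text \<open>A conditionally convergent improper integral; the value is meaningful only when
  the limit exists.\<close>

definition tail_integral :: "(real \<Rightarrow> real) \<Rightarrow> real \<Rightarrow> real" where
  "tail_integral g t = Lim at_top (\<lambda>T. integral {t..T} g)"

end

theory Submission
  imports Defs
begin

text \<open>Write \<open>\<phi> = F\<^sup>-\<^sup>1\<close>, so that \<open>\<phi>' = - f(\<phi>)\<close>.  The function \<open>P(t) = x(t) - \<integral>\<^sub>0\<^sup>t g\<close> has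
  \<open>P' = - f(x)\<close>.  If \<open>x/\<phi> \<rightarrow> l \<in> {-1, 0, 1}\<close>, the conditions on \<open>f\<close> give \<open>f(x)/f(\<phi>) \<rightarrow> l\<close>, and
  comparing derivatives shows that \<open>P\<close> converges with \<open>(P - P(\<infinity>))/\<phi> \<rightarrow> l\<close>; hence (a).  Conversely,
  (a) makes \<open>y(t) = x(t) + \<integral>\<^sub>t\<^sup>\<infinity> g\<close> a solution of \<open>y' = - f(x)\<close> with \<open>x - y = o(\<phi>)\<close>.  Since
  \<open>f(\<mu> u) < \<mu> f(u)\<close> for small \<open>u\<close>, once \<open>y\<close> is above a multiple of \<open>\<phi>\<close> at a late time, it stays
  above a slightly smaller multiple.  Then \<open>x/y \<rightarrow> 1\<close>, so \<open>(F(y))' \<rightarrow> 1\<close>, \<open>F(y(t)) \<sim> t\<close>, and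
  \<open>y/\<phi> \<rightarrow> 1\<close> because \<open>\<phi>\<close> decays at most polynomially.  By symmetry the only alternatives are
  \<open>y/\<phi> \<rightarrow> -1\<close> and \<open>y/\<phi> \<rightarrow> 0\<close>.\<close>

section \<open>Calculus on a half-line: a barrier argument and monotone limits\<close>

text \<open>A negative minimum over \<open>{a..b}\<close> cannot sit at \<open>a\<close>, and
  anywhere else the positive derivative yields smaller values just to its left. Later applied to
  \<open>y - \<epsilon> * \<phi>\<close>, whose derivative has a known sign only where the function
  is negative.\<close>

lemma nonneg_if_increasing_below_zero:
  fixes w w' :: "real \<Rightarrow> real"
  assumes deriv: "\<And>t. t \<ge> a \<Longrightarrow> (w has_real_derivative w' t) (at t)"
    and start: "w a \<ge> 0"
    and pos: "\<And>t. t \<ge> a \<Longrightarrow> w t < 0 \<Longrightarrow> w' t > 0"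
    and "b \<ge> a"
  shows "w b \<ge> 0"
proof (rule ccontr)
  assume neg: "\<not> w b \<ge> 0"
  have "continuous_on {a..b} w"
    using deriv by (intro DERIV_continuous_on) (auto intro: has_field_derivative_at_within)
  then obtain m where m: "m \<in> {a..b}" and min: "\<And>t. t \<in> {a..b} \<Longrightarrow> w m \<le> w t"
    using continuous_attains_inf[of "{a..b}" w] \<open>b \<ge> a\<close> by auto
  have wm: "w m < 0"
    using min[of b] neg \<open>b \<ge> a\<close> by simp
  with start m have "a < m"
    by (cases "a = m") auto
  obtain d where d: "d > 0" "\<And>h. h > 0 \<Longrightarrow> h < d \<Longrightarrow> w (m - h) < w m"
    using DERIV_pos_inc_left[OF deriv[of m] pos[of m]] wm m by auto
  define h where "h = min (d / 2) (m - a)"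
  have "h > 0" "h < d" "m - h \<in> {a..b}"
    using d \<open>a < m\<close> m by (auto simp: h_def)
  then show False
    using d(2)[of h] min[of "m - h"] by simp
qed

lemma nondecreasing_bounded_tendsto_at_top:
  fixes h :: "real \<Rightarrow> real"
  assumes mono: "\<And>s t. a \<le> s \<Longrightarrow> s \<le> t \<Longrightarrow> h s \<le> h t"
    and bound: "\<And>t. a \<le> t \<Longrightarrow> h t \<le> B"
  obtains l where "(h \<longlongrightarrow> l) at_top"
proof
  have bdd: "bdd_above (h ` {a..})"
    using bound by (auto intro!: bdd_aboveI[of _ B])
  show "(h \<longlongrightarrow> Sup (h ` {a..})) at_top"
  proof (rule increasing_tendsto)
    show "eventually (\<lambda>t. h t \<le> Sup (h ` {a..})) at_top"
      using eventually_ge_at_top[of a] by eventually_elim (auto intro!: cSup_upper bdd)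
    fix y assume "y < Sup (h ` {a..})"
    then obtain s where s: "s \<ge> a" "y < h s"
      using less_cSup_iff[OF _ bdd, of y] by auto
    show "eventually (\<lambda>t. y < h t) at_top"
      using eventually_ge_at_top[of s] by eventually_elim (use s mono in \<open>force intro: less_le_trans\<close>)
  qed
qed

text \<open>Only the consequences of the hypotheses on \<open>f\<close> that the argument needs: \<open>slow\<close> is the
  condition on \<open>\<Phi>\<close>, \<open>steep\<close> the one on the upper limit.\<close>

locale restoring_force =
  fixes f :: "real \<Rightarrow> real"
  assumes cont: "continuous_on UNIV f"
    and mono: "mono f"
    and odd: "\<And>u. f (- u) = - f u"
    and pos: "\<And>u. u > 0 \<Longrightarrow> f u > 0"
    and linear_bound: "\<exists>L>0. eventually (\<lambda>u. f u \<le> L * u) (at_right 0)"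
    and slow: "\<And>\<eta>. \<eta> > 0 \<Longrightarrow>
      \<exists>\<epsilon>. 0 < \<epsilon> \<and> \<epsilon> < 1 \<and> eventually (\<lambda>u. (1 - \<eta>) * f u \<le> f ((1 - \<epsilon>) * u)) (at_right 0)"
    and steep: "\<And>\<mu>. 0 < \<mu> \<Longrightarrow> \<mu> < 1 \<Longrightarrow>
      \<exists>c<\<mu>. eventually (\<lambda>u. f (\<mu> * u) \<le> c * f u) (at_right 0)"
begin

section \<open>The function \<open>F\<close> and its inverse \<open>\<phi>\<close>\<close>

abbreviation F where "F \<equiv> F_fun f"
abbreviation \<phi> where "\<phi> \<equiv> F_inv f"

lemma f_le: "u \<le> v \<Longrightarrow> f u \<le> f v"
  using mono by (rule monoD)

lemma F_deriv:
  assumes "u > 0"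
  shows "(F has_real_derivative - (1 / f u)) (at u)"
proof -
  \<comment> \<open>The fundamental theorem is applied on a compact interval that contains the base
    point \<open>1\<close> and has \<open>u\<close> in its interior, inside the region where
    \<open>f\<close> is positive.\<close>
  define a b where "a = min u 1 / 2" and "b = max u 1 + 1"
  have ab: "0 < a" "a < u" "u < b" "a \<le> 1" "1 \<le> b"
    using assms by (auto simp: a_def b_def)
  have "continuous_on {a..b} (\<lambda>v. 1 / f v)"
    using ab pos by (intro continuous_intros continuous_on_subset[OF cont]) (force simp: less_le)+
  from interval_integral_FTC2[OF ab(4,5) this, of u]
  have "((\<lambda>v. LBINT s=1..v. 1 / f s) has_vector_derivative 1 / f u) (at u within {a..b})"
    using ab by (simp add: one_ereal_def)
  then have "((\<lambda>v. LBINT s=1..v. 1 / f s) has_real_derivative 1 / f u) (at u)"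
    using ab by (simp add: has_real_derivative_iff_has_vector_derivative at_within_Icc_at)
  then have "((\<lambda>v. - (LBINT s=1..v. 1 / f s)) has_real_derivative - (1 / f u)) (at u)"
    by (rule DERIV_minus)
  moreover have "(\<lambda>v. - (LBINT s=1..v. 1 / f s)) = F"
    unfolding F_fun_def by (subst (2) interval_integral_endpoints_reverse) simp
  ultimately show ?thesis
    by simp
qed

lemma F_isCont: "u > 0 \<Longrightarrow> isCont F u"
  using F_deriv by (blast intro: DERIV_isCont)

lemma F_one: "F 1 = 0"
  by (simp add: F_fun_def one_ereal_def)

lemma F_strict_decreasing: "0 < u \<Longrightarrow> u < v \<Longrightarrow> F v < F u"
  by (rule DERIV_neg_imp_decreasing[where f = F])
    (use pos in \<open>auto intro!: exI[of _ "- (1 / f _)"] F_deriv\<close>)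

lemma F_decreasing: "0 < u \<Longrightarrow> u \<le> v \<Longrightarrow> F v \<le> F u"
  using F_strict_decreasing[of u v] by (cases "u = v") auto

lemma F_inj: "inj_on F {0<..}"
  by (rule linorder_inj_onI) (use F_strict_decreasing in force)+

text \<open>Near \<open>0\<close> the bound \<open>f u \<le> L * u\<close> makes
  \<open>1 / f\<close> at least \<open>1 / (L * u)\<close>, so \<open>F\<close> grows at least like
  \<open>- ln u / L\<close>. In differential form, \<open>F + ln / L\<close> is
  nonincreasing.\<close>

lemma F_at_right_0: "filterlim F at_top (at_right 0)"
proof -
  obtain L b where L: "L > 0" and b: "b > 0" "\<And>u. 0 < u \<Longrightarrow> u < b \<Longrightarrow> f u \<le> L * u"
    using linear_bound unfolding eventually_at_right_field by auto
  define c where "c = b / 2"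
  have c: "0 < c" "c < b" using b by (auto simp: c_def)
  have "F c + (ln c - ln u) / L \<le> F u" if u: "0 < u" "u < c" for u
  proof -
    have "F c + ln c / L \<le> F u + ln u / L"
    proof (rule DERIV_nonpos_imp_nonincreasing[where f = "\<lambda>v. F v + ln v / L"])
      fix v assume v: "u \<le> v" "v \<le> c"
      have "0 < v" "f v \<le> L * v" "0 < f v"
        using b(2)[of v] v u c pos[of v] by auto
      then have "- (1 / f v) + 1 / v / L \<le> 0"
        using L by (simp add: field_simps)
      moreover have "((\<lambda>v. F v + ln v / L) has_real_derivative (- (1 / f v) + 1 / v / L)) (at v)"
        using \<open>0 < v\<close> L by (auto intro!: derivative_eq_intros F_deriv)
      ultimately show "\<exists>d. ((\<lambda>v. F v + ln v / L) has_real_derivative d) (at v) \<and> d \<le> 0"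
        by blast
    qed (use u in simp)
    then show ?thesis by (simp add: diff_divide_distrib)
  qed
  then have ev: "eventually (\<lambda>u. F c + (ln c - ln u) / L \<le> F u) (at_right 0)"
    using c unfolding eventually_at_right_field by blast
  have "filterlim (\<lambda>u. F c + (ln c + (- ln u)) * (1 / L)) at_top (at_right 0)"
    using L ln_at_0
    by (intro filterlim_tendsto_add_at_top[OF tendsto_const]
        filterlim_at_top_mult_tendsto_pos[OF tendsto_const])
      (auto simp: filterlim_uminus_at_bot)
  then have "filterlim (\<lambda>u. F c + (ln c - ln u) / L) at_top (at_right 0)"
    by simp
  then show ?thesis
    by (rule filterlim_at_top_mono) (rule ev)
qed

text \<open>Intermediate values between a small \<open>a\<close> with \<open>F a \<ge> t\<close> and
  the point \<open>1\<close>, where \<open>F\<close> vanishes. Negative \<open>t\<close> are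
  excluded because the behaviour of \<open>F\<close> at infinity is not controlled.\<close>

lemma F_surj:
  assumes "t \<ge> 0"
  obtains u where "u > 0" "F u = t"
proof -
  have "eventually (\<lambda>u. t \<le> F u) (at_right 0)"
    using F_at_right_0 by (simp add: filterlim_at_top)
  moreover have "eventually (\<lambda>u. 0 < u \<and> u < (1::real)) (at_right 0)"
    by (auto simp: eventually_at_right_field intro: exI[of _ 1])
  ultimately have "eventually (\<lambda>u. t \<le> F u \<and> 0 < u \<and> u < 1) (at_right 0)"
    by eventually_elim auto
  then obtain a where a: "0 < a" "a < 1" "t \<le> F a"
    using eventually_happens'[of "at_right (0::real)"] by force
  have "\<exists>u\<ge>a. u \<le> 1 \<and> F u = t"
    using a assms F_one F_isCont by (intro IVT2) auto
  then obtain u where "a \<le> u" "F u = t" by blast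
  with a show ?thesis
    by (intro that[of u]) auto
qed

lemma \<phi>_pos: "t \<ge> 0 \<Longrightarrow> \<phi> t > 0"
  and F_\<phi>: "t \<ge> 0 \<Longrightarrow> F (\<phi> t) = t"
proof -
  assume "t \<ge> 0"
  then obtain u where "u > 0" "F u = t" by (rule F_surj)
  then have "t \<in> F ` {0<..}" by auto
  then show "\<phi> t > 0" "F (\<phi> t) = t"
    using inv_into_into[of t F "{0<..}"] f_inv_into_f[of t F "{0<..}"]
    by (auto simp: F_inv_def)
qed

lemma \<phi>_F: "u > 0 \<Longrightarrow> \<phi> (F u) = u"
  unfolding F_inv_def by (rule inv_into_f_f[OF F_inj]) simp

text \<open>The inverse function rule. Taking \<open>t > 0\<close> leaves an open interval around
  \<open>t\<close> on which \<open>F (\<phi> s) = s\<close>.\<close>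

lemma \<phi>_deriv:
  assumes "t > 0"
  shows "(\<phi> has_real_derivative - f (\<phi> t)) (at t)"
proof -
  have p: "\<phi> t > 0" using assms \<phi>_pos by simp
  have "isCont \<phi> (F (\<phi> t))"
    by (rule isCont_inverse_function2[where a = "\<phi> t / 2" and b = "\<phi> t + 1"])
      (use p in \<open>auto intro!: \<phi>_F F_isCont\<close>)
  then have "isCont \<phi> t"
    using F_\<phi> assms by simp
  then have "(\<phi> has_real_derivative inverse (- (1 / f (\<phi> t)))) (at t)"
    by (intro DERIV_inverse_function[where f = F and a = 0 and b = "t + 1"] F_deriv)
      (use assms p pos[OF p] F_\<phi> in auto)
  then show ?thesis by simp
qed

lemma \<phi>_tendsto_0: "(\<phi> \<longlongrightarrow> 0) at_top"
proof (rule tendstoI)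
  fix e :: real assume "e > 0"
  show "eventually (\<lambda>t. dist (\<phi> t) 0 < e) at_top"
    using eventually_gt_at_top[of "max 0 (F e)"]
  proof eventually_elim
    case (elim t)
    then have "\<not> e \<le> \<phi> t"
      using F_decreasing[OF \<open>e > 0\<close>, of "\<phi> t"] F_\<phi>[of t] by auto
    then show ?case
      using \<phi>_pos[of t] elim by simp
  qed
qed

section \<open>Decay of \<open>\<phi>\<close> at infinity is at most polynomial\<close>

lemma tendsto_at_right_0:
  "(a \<longlongrightarrow> (0::real)) at_top \<Longrightarrow> eventually (\<lambda>t. a t > 0) at_top \<Longrightarrow> filterlim a (at_right 0) at_top"
  unfolding filterlim_at by (auto elim: eventually_mono)

lemma eventually_pos_of_at_right_0:
  "filterlim a (at_right (0::real)) G \<Longrightarrow> eventually (\<lambda>t. a t > 0) G"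
  by (auto simp: filterlim_at elim: eventually_mono)

lemma \<phi>_at_right_0: "filterlim \<phi> (at_right 0) at_top"
  by (intro tendsto_at_right_0 \<phi>_tendsto_0 eventually_mono[OF eventually_ge_at_top[of 0]] \<phi>_pos)

text \<open>Since \<open>R(u) = F(u) f(u) / u\<close> satisfies \<open>R(u) \<le> c R(2u) + 1\<close> with \<open>c < 1\<close> near \<open>0\<close>, it is
  bounded there.\<close>

lemma F_times_f_bound: "\<exists>K>0. eventually (\<lambda>u. F u * f u \<le> K * u) (at_right 0)"
proof -
  obtain c' where c': "c' < 1/2" "eventually (\<lambda>u. f (1/2 * u) \<le> c' * f u) (at_right 0)"
    using steep[of "1/2"] by auto
  then obtain b where b: "b > 0" "\<And>u. 0 < u \<Longrightarrow> u < b \<Longrightarrow> f (1/2 * u) \<le> c' * f u"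
    unfolding eventually_at_right_field by auto
  define u0 where "u0 = min b 1 / 2"
  have u0: "0 < u0" "u0 < b" "u0 < 1" using b(1) by (auto simp: u0_def)
  have c'pos: "c' > 0"
  proof -
    have "0 < c' * f u0"
      using b(2)[OF u0(1,2)] pos[of "1/2 * u0"] u0 by simp
    then show ?thesis using pos[OF u0(1)] by (simp add: zero_less_mult_iff)
  qed
  \<comment> \<open>The first entry bounds \<open>F u * f u / u\<close> on the starting interval
    \<open>[u0 / 2, u0]\<close>; the second is the fixed point of
    \<open>K \<mapsto> 2 * c' * K + 1\<close>, so that any larger \<open>K\<close> survives the
    induction step.\<close>
  define K where "K = max (F (u0 / 2) * f u0 / (u0 / 2)) (1 / (1 - 2 * c'))"
  have K1: "1 / (1 - 2 * c') \<le> K" and K2: "F (u0 / 2) * f u0 / (u0 / 2) \<le> K"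
    by (auto simp: K_def)
  have K3: "2 * c' * K + 1 \<le> K"
    using K1 c'(1) by (simp add: field_simps)
  have "0 < 1 / (1 - 2 * c')" using c'(1) by simp
  with K1 have "K > 0" by linarith
  have F0: "0 \<le> F u" if "0 < u" "u \<le> u0" for u
    using F_decreasing[of u 1] F_one that u0 by simp
  \<comment> \<open>The induction extends the range towards \<open>0\<close>, halving its left end
    each time.\<close>
  have main: "\<forall>u. u0 / 2 ^ Suc n \<le> u \<and> u \<le> u0 \<longrightarrow> F u * f u \<le> K * u" for n
  proof (induction n)
    case 0
    show ?case
    proof (intro allI impI)
      fix u assume "u0 / 2 ^ Suc 0 \<le> u \<and> u \<le> u0"
      then have u: "u0 / 2 \<le> u" "u \<le> u0" by auto
      have "F u * f u \<le> F (u0 / 2) * f u0"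
        using u u0 pos[of u] F0[of "u0 / 2"]
        by (intro mult_mono F_decreasing f_le) (auto intro: less_imp_le)
      also have "\<dots> \<le> K * (u0 / 2)"
        using K2 u0 by (simp add: field_simps)
      also have "\<dots> \<le> K * u"
        using u \<open>K > 0\<close> by (intro mult_left_mono) auto
      finally show "F u * f u \<le> K * u" .
    qed
  next
    case (Suc n)
    show ?case
    proof (intro allI impI)
      fix u assume u: "u0 / 2 ^ Suc (Suc n) \<le> u \<and> u \<le> u0"
      have "0 < u0 / 2 ^ Suc (Suc n)" using u0 by simp
      with u have up: "u > 0" by linarith
      show "F u * f u \<le> K * u"
      proof (cases "u0 / 2 \<le> u")
        case True
        have "u0 / 2 ^ Suc n \<le> u0 / 2"
          using u0 by (simp add: field_simps)
        with True u show ?thesis using Suc.IH by force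
      next
        case False
        have "u0 / 2 ^ Suc n \<le> 2 * u" using u by (simp add: field_simps)
        with False have IH: "F (2 * u) * f (2 * u) \<le> K * (2 * u)" using Suc.IH by auto
        have half: "f u \<le> c' * f (2 * u)"
          using b(2)[of "2 * u"] False u0 up by simp
        \<comment> \<open>That is, the integral of \<open>1 / f\<close> over
          \<open>[u, 2 * u]\<close> is at most \<open>u / f u\<close>, because \<open>1 / f\<close>
          is nonincreasing.\<close>
        have "F u + u / f u \<le> F (2 * u) + 2 * u / f u"
        proof (rule DERIV_nonneg_imp_nondecreasing[where f = "\<lambda>v. F v + v / f u"])
          fix v assume v: "u \<le> v" "v \<le> 2 * u"
          have "((\<lambda>v. F v + v / f u) has_real_derivative - (1 / f v) + 1 / f u) (at v)"
            using v up pos[OF up] by (auto intro!: derivative_eq_intros F_deriv)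
          moreover have "1 / f v \<le> 1 / f u"
            using f_le[OF v(1)] pos[OF up] by (simp add: frac_le)
          ultimately show "\<exists>d. ((\<lambda>v. F v + v / f u) has_real_derivative d) (at v) \<and> 0 \<le> d"
            by (intro exI conjI) auto
        qed (use up in simp)
        then have "F u \<le> F (2 * u) + u / f u"
          by (simp add: mult.commute[of u] mult_2_right add_divide_distrib)
        then have "F u * f u \<le> (F (2 * u) + u / f u) * f u"
          using pos[OF up] by (intro mult_right_mono) auto
        also have "\<dots> = F (2 * u) * f u + u"
          using pos[OF up] by (simp add: field_simps)
        also have "F (2 * u) * f u \<le> F (2 * u) * (c' * f (2 * u))"
          using half F0[of "2 * u"] False up by (intro mult_left_mono) auto
        also have "\<dots> \<le> c' * (K * (2 * u))"
          using mult_left_mono[OF IH, of c'] c'pos by (simp add: algebra_simps)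
        also have "c' * (K * (2 * u)) + u = (2 * c' * K + 1) * u"
          by (simp add: algebra_simps)
        also have "\<dots> \<le> K * u"
          using K3 up by (intro mult_right_mono) auto
        finally show ?thesis by simp
      qed
    qed
  qed
  have "F u * f u \<le> K * u" if "0 < u" "u < u0" for u
  proof -
    obtain n where "u0 / u < 2 ^ n"
      using real_arch_pow[of 2] by auto
    then have "u0 < u * 2 ^ n" using that by (simp add: field_simps)
    also have "\<dots> \<le> u * 2 ^ Suc n" using that by simp
    finally have "u0 / 2 ^ Suc n \<le> u" by (simp add: field_simps)
    then show ?thesis using main[of n] that by auto
  qed
  then show ?thesis
    using u0 \<open>K > 0\<close> unfolding eventually_at_right_field by blast
qed

text \<open>At \<open>u = \<phi> t\<close> the bound on \<open>F * f\<close> reads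
  \<open>t * f (\<phi> t) \<le> K * \<phi> t\<close>, so the logarithmic derivative of
  \<open>\<phi>\<close> lies between \<open>- K / t\<close> and \<open>0\<close>.\<close>

lemma \<phi>_log_lipschitz:
  obtains K T where "K > 0" "T > 0"
    "\<And>s t. T \<le> s \<Longrightarrow> T \<le> t \<Longrightarrow> \<bar>ln (\<phi> s) - ln (\<phi> t)\<bar> \<le> K * \<bar>ln s - ln t\<bar>"
proof -
  obtain K where K: "K > 0" and ev: "eventually (\<lambda>u. F u * f u \<le> K * u) (at_right 0)"
    using F_times_f_bound by blast
  have "eventually (\<lambda>t. F (\<phi> t) * f (\<phi> t) \<le> K * \<phi> t) at_top"
    by (rule eventually_compose_filterlim[OF ev \<phi>_at_right_0])
  then obtain T' where T': "\<And>t. t \<ge> T' \<Longrightarrow> F (\<phi> t) * f (\<phi> t) \<le> K * \<phi> t"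
    by (auto simp: eventually_at_top_linorder)
  define T where "T = max 1 T'"
  have T: "T > 0" by (simp add: T_def)
  have ordered: "\<bar>ln (\<phi> s) - ln (\<phi> t)\<bar> \<le> K * \<bar>ln s - ln t\<bar>" if st: "T \<le> s" "s \<le> t" for s t
  proof -
    have D: "((\<lambda>r. ln (\<phi> r)) has_real_derivative - f (\<phi> r) / \<phi> r) (at r)" if "r \<ge> T" for r
      using \<phi>_pos[of r] that T
      by (auto intro!: derivative_eq_intros \<phi>_deriv simp: field_simps)
    have "ln (\<phi> s) + K * ln s \<le> ln (\<phi> t) + K * ln t"
    proof (rule DERIV_nonneg_imp_nondecreasing[where f = "\<lambda>r. ln (\<phi> r) + K * ln r"])
      fix r assume r: "s \<le> r" "r \<le> t"
      have rp: "r > 0" "\<phi> r > 0" using \<phi>_pos[of r] r st T by auto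
      have "r * f (\<phi> r) \<le> K * \<phi> r"
        using T'[of r] F_\<phi>[of r] r st rp by (simp add: T_def)
      then have "0 \<le> - f (\<phi> r) / \<phi> r + K * (1 / r)"
        using rp by (simp add: field_simps)
      moreover have "((\<lambda>r. ln (\<phi> r) + K * ln r) has_real_derivative - f (\<phi> r) / \<phi> r + K * (1 / r)) (at r)"
        using r st rp by (intro DERIV_add D DERIV_cmult) (auto intro!: derivative_eq_intros)
      ultimately show "\<exists>d. ((\<lambda>r. ln (\<phi> r) + K * ln r) has_real_derivative d) (at r) \<and> 0 \<le> d"
        by blast
    qed (use st in simp)
    moreover have "ln (\<phi> t) \<le> ln (\<phi> s)"
    proof (rule DERIV_nonpos_imp_nonincreasing[where f = "\<lambda>r. ln (\<phi> r)"])
      fix r assume r: "s \<le> r" "r \<le> t"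
      have "\<phi> r > 0" using \<phi>_pos[of r] r st T by auto
      then have "- f (\<phi> r) / \<phi> r \<le> 0" using pos[of "\<phi> r"] by simp
      with D[of r] r st show "\<exists>d. ((\<lambda>r. ln (\<phi> r)) has_real_derivative d) (at r) \<and> d \<le> 0"
        by auto
    qed (use st in simp)
    moreover have "ln s \<le> ln t" using st T by simp
    ultimately show ?thesis by (simp add: algebra_simps)
  qed
  show ?thesis
  proof (rule that[OF K T])
    fix s t assume "T \<le> s" "T \<le> t"
    then show "\<bar>ln (\<phi> s) - ln (\<phi> t)\<bar> \<le> K * \<bar>ln s - ln t\<bar>"
      using ordered[of s t] ordered[of t s] by (cases "s \<le> t") (auto simp: abs_minus_commute)
  qed
qed

text \<open>\<open>ln (\<tau> t) - ln t\<close> tends to \<open>0\<close>, and the Lipschitz bound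
  passes this on to \<open>ln \<phi>\<close>. Slow decay is essential: \<open>exp (- t)\<close>
  fails for \<open>\<tau> t = t + sqrt t\<close>.\<close>

lemma \<phi>_asymp:
  assumes lim: "((\<lambda>t. \<tau> t / t) \<longlongrightarrow> 1) at_top"
  shows "((\<lambda>t. \<phi> (\<tau> t) / \<phi> t) \<longlongrightarrow> 1) at_top"
proof -
  obtain K T where KT: "K > 0" "T > 0"
    and lip: "\<And>s t. T \<le> s \<Longrightarrow> T \<le> t \<Longrightarrow> \<bar>ln (\<phi> s) - ln (\<phi> t)\<bar> \<le> K * \<bar>ln s - ln t\<bar>"
    using \<phi>_log_lipschitz by metis
  have "eventually (\<lambda>t. \<tau> t / t > 1/2) at_top"
    by (rule order_tendstoD(1)[OF lim]) simp
  with eventually_ge_at_top[of "2 * T"]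
  have ev: "eventually (\<lambda>t. T \<le> t \<and> T \<le> \<tau> t) at_top"
    by eventually_elim (use KT in \<open>auto simp: field_simps\<close>)
  have "((\<lambda>t. K * \<bar>ln (\<tau> t / t)\<bar>) \<longlongrightarrow> K * \<bar>ln 1\<bar>) at_top"
    by (intro tendsto_intros lim) simp
  then have "((\<lambda>t. K * \<bar>ln (\<tau> t / t)\<bar>) \<longlongrightarrow> 0) at_top" by simp
  moreover have "eventually (\<lambda>t. norm (ln (\<phi> (\<tau> t)) - ln (\<phi> t)) \<le> K * \<bar>ln (\<tau> t / t)\<bar>) at_top"
    using ev
  proof eventually_elim
    case (elim t)
    then show ?case using lip[of "\<tau> t" t] KT by (simp add: ln_div)
  qed
  ultimately have "((\<lambda>t. ln (\<phi> (\<tau> t)) - ln (\<phi> t)) \<longlongrightarrow> 0) at_top"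
    by (rule Lim_null_comparison[rotated])
  then have "((\<lambda>t. exp (ln (\<phi> (\<tau> t)) - ln (\<phi> t))) \<longlongrightarrow> exp 0) at_top"
    by (rule tendsto_exp)
  moreover have "eventually (\<lambda>t. exp (ln (\<phi> (\<tau> t)) - ln (\<phi> t)) = \<phi> (\<tau> t) / \<phi> t) at_top"
    using ev
  proof eventually_elim
    case (elim t)
    then have "\<phi> (\<tau> t) > 0" "\<phi> t > 0" using \<phi>_pos KT by auto
    then show ?case by (simp add: exp_diff)
  qed
  ultimately show ?thesis
    by (simp add: tendsto_cong)
qed

section \<open>How \<open>f\<close> acts on ratios of functions tending to zero\<close>

text \<open>Eventually \<open>b t \<ge> (1 - e) * a t\<close>, so monotonicity reduces the claim to
  \<open>slow\<close>. The matching upper bound comes from exchanging \<open>a\<close> and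
  \<open>b\<close>.\<close>

lemma f_ratio_lower:
  assumes a: "filterlim a (at_right 0) at_top" and b: "filterlim b (at_right 0) at_top"
    and lim: "((\<lambda>t. b t / a t) \<longlongrightarrow> 1) at_top" and "\<eta> > 0"
  shows "eventually (\<lambda>t. (1 - \<eta>) * f (a t) \<le> f (b t)) at_top"
proof -
  obtain e where e: "0 < e" "e < 1"
    and ev: "eventually (\<lambda>u. (1 - \<eta>) * f u \<le> f ((1 - e) * u)) (at_right 0)"
    using slow[OF \<open>\<eta> > 0\<close>] by blast
  have "eventually (\<lambda>t. b t / a t > 1 - e) at_top"
    by (rule order_tendstoD(1)[OF lim]) (use e in simp)
  moreover have "eventually (\<lambda>t. a t > 0) at_top"
    using a by (rule eventually_pos_of_at_right_0)
  moreover have "eventually (\<lambda>t. (1 - \<eta>) * f (a t) \<le> f ((1 - e) * a t)) at_top"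
    by (rule eventually_compose_filterlim[OF ev a])
  ultimately show ?thesis
  proof eventually_elim
    case (elim t)
    then have "(1 - e) * a t \<le> b t" by (simp add: field_simps)
    from f_le[OF this] elim show ?case by simp
  qed
qed

lemma f_ratio_tendsto_1:
  assumes a: "filterlim a (at_right 0) at_top" and b: "filterlim b (at_right 0) at_top"
    and lim: "((\<lambda>t. b t / a t) \<longlongrightarrow> 1) at_top"
  shows "((\<lambda>t. f (b t) / f (a t)) \<longlongrightarrow> 1) at_top"
proof -
  have ap: "eventually (\<lambda>t. f (a t) > 0) at_top" and bp: "eventually (\<lambda>t. f (b t) > 0) at_top"
    by (rule eventually_mono[OF eventually_pos_of_at_right_0], fact, erule pos)+
  have lim': "((\<lambda>t. a t / b t) \<longlongrightarrow> 1) at_top"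
    using tendsto_inverse[OF lim] by simp
  show ?thesis
  proof (rule order_tendstoI)
    fix r :: real assume r: "r < 1"
    define \<eta> where "\<eta> = (1 - r) / 2"
    have "\<eta> > 0" "r < 1 - \<eta>" using r by (auto simp: \<eta>_def field_simps)
    from f_ratio_lower[OF a b lim this(1)] ap
    show "eventually (\<lambda>t. r < f (b t) / f (a t)) at_top"
    proof eventually_elim
      case (elim t)
      then have "1 - \<eta> \<le> f (b t) / f (a t)" by (simp add: field_simps)
      with \<open>r < 1 - \<eta>\<close> show ?case by linarith
    qed
  next
    fix r :: real assume r: "r > 1"
    \<comment> \<open>The value is chosen so that \<open>1 / r < 1 - \<eta>\<close>; the lower bound
      for \<open>f (a t) / f (b t)\<close> then exceeds \<open>1 / r\<close>.\<close>
    define \<eta> where "\<eta> = (1 - 1 / r) / 2"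
    have \<eta>: "\<eta> > 0" "1 / r < 1 - \<eta>" using r by (auto simp: \<eta>_def field_simps)
    from f_ratio_lower[OF b a lim' \<eta>(1)] ap bp
    show "eventually (\<lambda>t. f (b t) / f (a t) < r) at_top"
    proof eventually_elim
      case (elim t)
      have "1 / r * f (b t) < (1 - \<eta>) * f (b t)"
        using \<eta> elim by (intro mult_strict_right_mono) auto
      with elim have "1 / r * f (b t) < f (a t)" by linarith
      with elim r show ?case by (simp add: field_simps)
    qed
  qed
qed

text \<open>For any small \<open>\<mu>\<close>, eventually
  \<open>\<bar>b t\<bar> \<le> \<mu> * a t\<close>, and \<open>steep\<close> bounds
  \<open>f (\<mu> * a t)\<close> by less than \<open>\<mu> * f (a t)\<close>. Since \<open>b\<close>
  may change sign, oddness supplies the bound from below.\<close>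

lemma f_ratio_tendsto_0:
  assumes a: "filterlim a (at_right 0) at_top"
    and lim: "((\<lambda>t. b t / a t) \<longlongrightarrow> 0) at_top"
  shows "((\<lambda>t. f (b t) / f (a t)) \<longlongrightarrow> 0) at_top"
proof (rule tendstoI)
  fix e :: real assume "e > 0"
  define \<mu> where "\<mu> = min e 1 / 2"
  have \<mu>: "0 < \<mu>" "\<mu> < 1" "\<mu> < e" using \<open>e > 0\<close> by (auto simp: \<mu>_def)
  obtain c where c: "c < \<mu>" "eventually (\<lambda>u. f (\<mu> * u) \<le> c * f u) (at_right 0)"
    using steep[OF \<mu>(1,2)] by blast
  have "eventually (\<lambda>t. dist (b t / a t) 0 < \<mu>) at_top"
    using lim \<mu>(1) by (rule tendstoD)
  moreover have "eventually (\<lambda>t. a t > 0) at_top"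
    using a by (rule eventually_pos_of_at_right_0)
  moreover have "eventually (\<lambda>t. f (\<mu> * a t) \<le> c * f (a t)) at_top"
    by (rule eventually_compose_filterlim[OF c(2) a])
  ultimately show "eventually (\<lambda>t. dist (f (b t) / f (a t)) 0 < e) at_top"
  proof eventually_elim
    case (elim t)
    have fa: "f (a t) > 0" using elim pos by simp
    have "\<bar>b t\<bar> \<le> \<mu> * a t" using elim by (simp add: field_simps)
    then have "f (b t) \<le> f (\<mu> * a t)" "f (- b t) \<le> f (\<mu> * a t)"
      by (auto intro!: f_le)
    then have "\<bar>f (b t)\<bar> \<le> c * f (a t)" using elim odd[of "b t"] by linarith
    also have "\<dots> < e * f (a t)" using fa c \<mu> by (intro mult_strict_right_mono) auto
    finally show ?case using fa by (simp add: field_simps)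
  qed
qed

text \<open>The same \<open>l\<close> appears before and after applying \<open>f\<close>: for an odd
  power with exponent above \<open>1\<close>, the values \<open>-1, 0, 1\<close> are exactly the
  fixed points. The case \<open>-1\<close> follows from \<open>1\<close> by oddness.\<close>

lemma f_ratio_\<phi>:
  assumes l: "l \<in> {-1, 0, 1}" and lim: "((\<lambda>t. x t / \<phi> t) \<longlongrightarrow> l) at_top"
  shows "((\<lambda>t. f (x t) / f (\<phi> t)) \<longlongrightarrow> l) at_top"
proof -
  have one: "((\<lambda>t. f (z t) / f (\<phi> t)) \<longlongrightarrow> 1) at_top" if z: "((\<lambda>t. z t / \<phi> t) \<longlongrightarrow> 1) at_top" for z
  proof (rule f_ratio_tendsto_1[OF \<phi>_at_right_0 _ z])
    have p: "eventually (\<lambda>t. \<phi> t > 0) at_top"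
      using \<phi>_at_right_0 by (rule eventually_pos_of_at_right_0)
    have "((\<lambda>t. z t / \<phi> t * \<phi> t) \<longlongrightarrow> 1 * 0) at_top"
      by (intro tendsto_mult z \<phi>_tendsto_0)
    moreover have "eventually (\<lambda>t. z t / \<phi> t * \<phi> t = z t) at_top"
      using p by eventually_elim simp
    ultimately have "(z \<longlongrightarrow> 0) at_top" by (simp add: tendsto_cong)
    moreover have "eventually (\<lambda>t. z t > 0) at_top"
    proof -
      have "eventually (\<lambda>t. z t / \<phi> t > 0) at_top"
        by (rule order_tendstoD(1)[OF z]) simp
      with p show ?thesis by eventually_elim (simp add: zero_less_divide_iff)
    qed
    ultimately show "filterlim z (at_right 0) at_top" by (rule tendsto_at_right_0)
  qed
  consider "l = -1" | "l = 0" | "l = 1" using l by auto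
  then show ?thesis
  proof cases
    case 1
    have "((\<lambda>t. (- x t) / \<phi> t) \<longlongrightarrow> 1) at_top"
      using tendsto_minus[OF lim] 1 by simp
    from tendsto_minus[OF one[OF this]] 1 show ?thesis by (simp add: odd)
  next
    case 2
    with lim show ?thesis using f_ratio_tendsto_0[OF \<phi>_at_right_0] by simp
  next
    case 3
    with lim one show ?thesis by simp
  qed
qed

section \<open>Integrating \<open>f (x t)\<close> when \<open>x\<close> is comparable to
  \<open>\<phi>\<close>\<close>

text \<open>The comparison functions \<open>P - (l \<plusminus> \<eta>) \<phi>\<close> are eventually monotone; this replaces
  l'Hospital's rule for \<open>0/0\<close> at infinity and yields the existence of the limit of \<open>P\<close> as well.\<close>

lemma antiderivative_asymp:
  assumes deriv: "\<And>t. t > 0 \<Longrightarrow> (P has_real_derivative - f (x t)) (at t)"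
    and lim: "((\<lambda>t. f (x t) / f (\<phi> t)) \<longlongrightarrow> l) at_top"
  obtains p where "(P \<longlongrightarrow> p) at_top" "((\<lambda>t. (P t - p) / \<phi> t) \<longlongrightarrow> l) at_top"
proof -
  have sandwich: "\<exists>T>0. (\<forall>s t. T \<le> s \<longrightarrow> s \<le> t \<longrightarrow>
      P s - (l + \<eta>) * \<phi> s \<le> P t - (l + \<eta>) * \<phi> t \<and>
      P t - (l - \<eta>) * \<phi> t \<le> P s - (l - \<eta>) * \<phi> s)" if "\<eta> > 0" for \<eta>
  proof -
    have "eventually (\<lambda>t. dist (f (x t) / f (\<phi> t)) l < \<eta>) at_top"
      using lim that by (rule tendstoD)
    then obtain T' where T': "\<And>t. t \<ge> T' \<Longrightarrow> \<bar>f (x t) / f (\<phi> t) - l\<bar> < \<eta>"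
      by (auto simp: eventually_at_top_linorder dist_real_def)
    define T where "T = max 1 T'"
    have bd: "f (x t) \<le> (l + \<eta>) * f (\<phi> t)" "(l - \<eta>) * f (\<phi> t) \<le> f (x t)" if "t \<ge> T" for t
    proof -
      have "f (\<phi> t) > 0" using that \<phi>_pos pos by (simp add: T_def)
      moreover have "f (x t) / f (\<phi> t) \<le> l + \<eta>" "l - \<eta> \<le> f (x t) / f (\<phi> t)"
        using T'[of t] that by (auto simp: T_def abs_less_iff)
      ultimately show "f (x t) \<le> (l + \<eta>) * f (\<phi> t)" "(l - \<eta>) * f (\<phi> t) \<le> f (x t)"
        by (auto simp: field_simps)
    qed
    have D: "((\<lambda>t. P t - k * \<phi> t) has_real_derivative - f (x t) + k * f (\<phi> t)) (at t)" if "t \<ge> T" for t k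
      using that by (auto intro!: derivative_eq_intros deriv \<phi>_deriv simp: T_def)
    show ?thesis
    proof (intro exI[of _ T] conjI allI impI)
      show "T > 0" by (simp add: T_def)
      fix s t assume st: "T \<le> s" "s \<le> t"
      show "P s - (l + \<eta>) * \<phi> s \<le> P t - (l + \<eta>) * \<phi> t"
      proof (rule DERIV_nonneg_imp_nondecreasing[where f = "\<lambda>t. P t - (l + \<eta>) * \<phi> t", OF st(2)])
        fix r assume "s \<le> r"
        then show "\<exists>d. ((\<lambda>t. P t - (l + \<eta>) * \<phi> t) has_real_derivative d) (at r) \<and> 0 \<le> d"
          using D[of r "l + \<eta>"] bd(1)[of r] st by (intro exI conjI) auto
      qed
      show "P t - (l - \<eta>) * \<phi> t \<le> P s - (l - \<eta>) * \<phi> s"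
      proof (rule DERIV_nonpos_imp_nonincreasing[where f = "\<lambda>t. P t - (l - \<eta>) * \<phi> t", OF st(2)])
        fix r assume "s \<le> r"
        then show "\<exists>d. ((\<lambda>t. P t - (l - \<eta>) * \<phi> t) has_real_derivative d) (at r) \<and> d \<le> 0"
          using D[of r "l - \<eta>"] bd(2)[of r] st by (intro exI conjI) auto
      qed
    qed
  qed
  obtain T where T: "T > 0" and
    up: "\<And>s t. T \<le> s \<Longrightarrow> s \<le> t \<Longrightarrow> P s - (l + 1) * \<phi> s \<le> P t - (l + 1) * \<phi> t" and
    down: "\<And>s t. T \<le> s \<Longrightarrow> s \<le> t \<Longrightarrow> P t - (l - 1) * \<phi> t \<le> P s - (l - 1) * \<phi> s"
    using sandwich[of 1] by auto
  \<comment> \<open>As \<open>\<phi>\<close> is positive, the increasing comparison function lies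
    below the decreasing one, hence below the value of the latter at \<open>T\<close>.\<close>
  have "P t - (l + 1) * \<phi> t \<le> P T - (l - 1) * \<phi> T" if "T \<le> t" for t
    using down[OF _ that] \<phi>_pos[of t] that T by (simp add: algebra_simps)
  from nondecreasing_bounded_tendsto_at_top[of T "\<lambda>t. P t - (l + 1) * \<phi> t", OF up this]
  obtain p where p: "((\<lambda>t. P t - (l + 1) * \<phi> t) \<longlongrightarrow> p) at_top" by blast
  have "((\<lambda>t. (P t - (l + 1) * \<phi> t) + (l + 1) * \<phi> t) \<longlongrightarrow> p + (l + 1) * 0) at_top"
    by (intro tendsto_intros p \<phi>_tendsto_0)
  then have P: "(P \<longlongrightarrow> p) at_top" by simp
  have Pk: "((\<lambda>t. P t - k * \<phi> t) \<longlongrightarrow> p) at_top" for k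
    using tendsto_diff[OF P tendsto_mult[OF tendsto_const \<phi>_tendsto_0, of k]] by simp
  have "((\<lambda>t. (P t - p) / \<phi> t) \<longlongrightarrow> l) at_top"
  proof (rule tendstoI)
    fix e :: real assume "e > 0"
    then obtain T where T: "T > 0" and
      up: "\<And>s t. T \<le> s \<Longrightarrow> s \<le> t \<Longrightarrow> P s - (l + e / 2) * \<phi> s \<le> P t - (l + e / 2) * \<phi> t" and
      down: "\<And>s t. T \<le> s \<Longrightarrow> s \<le> t \<Longrightarrow> P t - (l - e / 2) * \<phi> t \<le> P s - (l - e / 2) * \<phi> s"
      using sandwich[of "e / 2"] by auto
    show "eventually (\<lambda>t. dist ((P t - p) / \<phi> t) l < e) at_top"
      using eventually_ge_at_top[of T]
    proof eventually_elim
      case (elim s)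
      \<comment> \<open>Both comparison functions tend to \<open>p\<close> because
        \<open>\<phi>\<close> vanishes at infinity, and a monotone function stays on one side of its
        limit.\<close>
      have "P s - (l + e / 2) * \<phi> s \<le> p"
        by (rule tendsto_lowerbound[OF Pk[of "l + e / 2"]])
          (use elim up in \<open>auto intro!: eventually_at_top_linorderI[of s]\<close>)
      moreover have "p \<le> P s - (l - e / 2) * \<phi> s"
        by (rule tendsto_upperbound[OF Pk[of "l - e / 2"]])
          (use elim down in \<open>auto intro!: eventually_at_top_linorderI[of s]\<close>)
      moreover have p: "\<phi> s > 0" using \<phi>_pos elim T by simp
      ultimately have "(P s - p) / \<phi> s \<le> l + e / 2" "l - e / 2 \<le> (P s - p) / \<phi> s"
        by (auto simp: field_simps)
      with \<open>e > 0\<close> show ?case by (simp add: dist_real_def abs_less_iff)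
    qed
  qed
  with P show ?thesis by (rule that)
qed

section \<open>Trichotomy for the perturbed equation\<close>

text \<open>Whenever \<open>y\<close> is below \<open>\<epsilon> * \<phi>\<close> at a late time,
  \<open>x\<close> is at most \<open>\<mu> * \<phi>\<close>, so
  \<open>f (x t) \<le> c * f (\<phi> t) < \<epsilon> * f (\<phi> t)\<close>. Then \<open>y\<close>
  decreases more slowly than \<open>\<epsilon> * \<phi>\<close> and cannot fall below this
  barrier.\<close>

lemma eventually_ge_if_frequently_ge:
  assumes deriv: "\<And>t. t > 0 \<Longrightarrow> (y has_real_derivative - f (x t)) (at t)"
    and close: "((\<lambda>t. (x t - y t) / \<phi> t) \<longlongrightarrow> 0) at_top"
    and \<mu>: "0 < \<mu>" "\<mu> < 1"
    and freq: "frequently (\<lambda>t. \<mu> * \<phi> t \<le> y t) at_top"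
  obtains \<epsilon> where "\<epsilon> > 0" "eventually (\<lambda>t. \<epsilon> * \<phi> t \<le> y t) at_top"
proof -
  obtain c where c: "c < \<mu>" and ev: "eventually (\<lambda>u. f (\<mu> * u) \<le> c * f u) (at_right 0)"
    using steep[OF \<mu>] by blast
  \<comment> \<open>\<open>\<epsilon> > c\<close> makes the derivative comparison strict, while the
    gap \<open>\<mu> - \<epsilon>\<close> absorbs \<open>x - y\<close>. The maximum with
    \<open>0\<close> keeps \<open>\<epsilon>\<close> positive.\<close>
  define \<epsilon> where "\<epsilon> = (max c 0 + \<mu>) / 2"
  have \<epsilon>: "0 < \<epsilon>" "c < \<epsilon>" "\<epsilon> < \<mu>" using c \<mu> by (auto simp: \<epsilon>_def)
  have "eventually (\<lambda>t. f (\<mu> * \<phi> t) \<le> c * f (\<phi> t)) at_top"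
    by (rule eventually_compose_filterlim[OF ev \<phi>_at_right_0])
  moreover have "eventually (\<lambda>t. (x t - y t) / \<phi> t < \<mu> - \<epsilon>) at_top"
    by (rule order_tendstoD(2)[OF close]) (use \<epsilon> in simp)
  ultimately have "eventually (\<lambda>t. 0 < t \<and> f (\<mu> * \<phi> t) \<le> c * f (\<phi> t) \<and> (x t - y t) / \<phi> t < \<mu> - \<epsilon>) at_top"
    using eventually_gt_at_top[of 0] by eventually_elim auto
  then obtain T where T: "\<And>t. t \<ge> T \<Longrightarrow>
      0 < t \<and> f (\<mu> * \<phi> t) \<le> c * f (\<phi> t) \<and> (x t - y t) / \<phi> t < \<mu> - \<epsilon>"
    by (auto simp: eventually_at_top_linorder)
  have "frequently (\<lambda>t. \<mu> * \<phi> t \<le> y t \<and> t \<ge> T) at_top"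
    using freq eventually_ge_at_top[of T] by (rule frequently_eventually_frequently)
  then obtain a where a: "\<mu> * \<phi> a \<le> y a" "a \<ge> T"
    by (auto dest!: frequently_ex)
  have "\<epsilon> * \<phi> b \<le> y b" if "b \<ge> a" for b
  proof -
    have "0 \<le> y b - \<epsilon> * \<phi> b"
    proof (rule nonneg_if_increasing_below_zero[where w = "\<lambda>t. y t - \<epsilon> * \<phi> t"
          and w' = "\<lambda>t. - f (x t) + \<epsilon> * f (\<phi> t)", OF _ _ _ that])
      fix t assume t: "t \<ge> a"
      then have tp: "t > 0" using T[of t] a by auto
      then show "((\<lambda>t. y t - \<epsilon> * \<phi> t) has_real_derivative - f (x t) + \<epsilon> * f (\<phi> t)) (at t)"
        by (auto intro!: derivative_eq_intros deriv \<phi>_deriv)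
      have p: "\<phi> t > 0" "f (\<phi> t) > 0" using \<phi>_pos pos tp by auto
      assume "y t - \<epsilon> * \<phi> t < 0"
      moreover have "x t - y t < (\<mu> - \<epsilon>) * \<phi> t"
        using T[of t] t a p by (simp add: field_simps)
      ultimately have "x t \<le> \<mu> * \<phi> t" by (simp add: algebra_simps)
      from f_le[OF this] have "f (x t) \<le> c * f (\<phi> t)"
        using T[of t] t a by simp
      also have "\<dots> < \<epsilon> * f (\<phi> t)" using p \<epsilon> by simp
      finally show "0 < - f (x t) + \<epsilon> * f (\<phi> t)" by simp
    next
      have "\<epsilon> * \<phi> a \<le> \<mu> * \<phi> a"
        using \<epsilon> \<phi>_pos[of a] T[of a] a by (intro mult_right_mono) auto
      with a show "0 \<le> y a - \<epsilon> * \<phi> a" by simp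
    qed
    then show ?thesis by simp
  qed
  then have "eventually (\<lambda>t. \<epsilon> * \<phi> t \<le> y t) at_top"
    by (auto simp: eventually_at_top_linorder)
  with \<epsilon>(1) show ?thesis by (rule that)
qed

text \<open>Along such a \<open>y\<close> one has \<open>(F \<circ> y)' = f(x) / f(y) \<rightarrow> 1\<close>, so \<open>F(y(t)) \<sim> t\<close>.\<close>

lemma tendsto_1_if_frequently_ge:
  assumes deriv: "\<And>t. t > 0 \<Longrightarrow> (y has_real_derivative - f (x t)) (at t)"
    and y0: "(y \<longlongrightarrow> 0) at_top"
    and close: "((\<lambda>t. (x t - y t) / \<phi> t) \<longlongrightarrow> 0) at_top"
    and \<mu>: "0 < \<mu>" "\<mu> < 1"
    and freq: "frequently (\<lambda>t. \<mu> * \<phi> t \<le> y t) at_top"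
  shows "((\<lambda>t. y t / \<phi> t) \<longlongrightarrow> 1) at_top"
proof -
  obtain \<epsilon> where \<epsilon>: "\<epsilon> > 0" and ge: "eventually (\<lambda>t. \<epsilon> * \<phi> t \<le> y t) at_top"
    using eventually_ge_if_frequently_ge[OF deriv close \<mu> freq] by blast
  have \<phi>p: "eventually (\<lambda>t. \<phi> t > 0) at_top"
    using \<phi>_at_right_0 by (rule eventually_pos_of_at_right_0)
  have yp: "eventually (\<lambda>t. y t > 0) at_top"
    using ge \<phi>p by eventually_elim (use \<epsilon> in \<open>auto intro: less_le_trans[OF mult_pos_pos]\<close>)
  have y_right: "filterlim y (at_right 0) at_top"
    using y0 yp by (rule tendsto_at_right_0)
  \<comment> \<open>As \<open>y\<close> is at least \<open>\<epsilon> * \<phi>\<close>, an error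
    that is small relative to \<open>\<phi>\<close> is small relative to \<open>y\<close>.\<close>
  have "((\<lambda>t. (x t - y t) / y t) \<longlongrightarrow> 0) at_top"
  proof (rule tendsto_0_le[OF close, where K = "1 / \<epsilon>"])
    show "eventually (\<lambda>t. norm ((x t - y t) / y t) \<le> norm ((x t - y t) / \<phi> t) * (1 / \<epsilon>)) at_top"
      using ge yp \<phi>p
    proof eventually_elim
      case (elim t)
      have "\<bar>x t - y t\<bar> / y t \<le> \<bar>x t - y t\<bar> / (\<epsilon> * \<phi> t)"
        using elim \<epsilon> by (intro divide_left_mono) auto
      with elim \<epsilon> show ?case by (simp add: abs_divide mult.commute)
    qed
  qed
  then have "((\<lambda>t. (x t - y t) / y t + 1) \<longlongrightarrow> 0 + 1) at_top"
    by (intro tendsto_intros)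
  moreover have "eventually (\<lambda>t. (x t - y t) / y t + 1 = x t / y t) at_top"
    using yp by eventually_elim (simp add: field_simps)
  ultimately have xy: "((\<lambda>t. x t / y t) \<longlongrightarrow> 1) at_top"
    by (simp add: tendsto_cong)
  have xp: "eventually (\<lambda>t. x t > 0) at_top"
  proof -
    have "eventually (\<lambda>t. x t / y t > 0) at_top"
      by (rule order_tendstoD(1)[OF xy]) simp
    with yp show ?thesis by eventually_elim (simp add: zero_less_divide_iff)
  qed
  have "((\<lambda>t. x t / y t * y t) \<longlongrightarrow> 1 * 0) at_top"
    by (intro tendsto_mult xy y0)
  moreover have "eventually (\<lambda>t. x t / y t * y t = x t) at_top"
    using yp by eventually_elim simp
  ultimately have "(x \<longlongrightarrow> 0) at_top" by (simp add: tendsto_cong)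
  with xp have "filterlim x (at_right 0) at_top" by (intro tendsto_at_right_0)
  from f_ratio_tendsto_1[OF y_right this xy]
  have ratio: "((\<lambda>t. f (x t) / f (y t)) \<longlongrightarrow> 1) at_top" .
  have "((\<lambda>t. F (y t) / t) \<longlongrightarrow> 1) at_top"
  proof (rule lhospital_at_top_at_top[where f' = "\<lambda>t. f (x t) / f (y t)" and g' = "\<lambda>_. 1"])
    show "eventually (\<lambda>t. ((\<lambda>t. F (y t)) has_real_derivative f (x t) / f (y t)) (at t)) at_top"
      using yp eventually_gt_at_top[of 0]
    proof eventually_elim
      case (elim t)
      then show ?case
        using DERIV_chain2[OF F_deriv deriv, of t] by simp
    qed
  qed (use ratio in \<open>auto simp: filterlim_ident\<close>)
  \<comment> \<open>Here \<open>\<tau> t = F (y t)\<close>; applying \<open>\<phi>\<close> recovers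
    \<open>y t\<close>.\<close>
  from \<phi>_asymp[OF this] have "((\<lambda>t. \<phi> (F (y t)) / \<phi> t) \<longlongrightarrow> 1) at_top" .
  moreover have "eventually (\<lambda>t. \<phi> (F (y t)) / \<phi> t = y t / \<phi> t) at_top"
    using yp by eventually_elim (simp add: \<phi>_F)
  ultimately show ?thesis by (simp add: tendsto_cong)
qed

text \<open>If neither \<open>y\<close> nor \<open>- y\<close> reaches any fixed multiple
  \<open>\<mu> * \<phi>\<close> at arbitrarily late times, then \<open>y / \<phi>\<close> tends to
  \<open>0\<close>. Otherwise the barrier argument applies to \<open>y\<close> or, since
  \<open>f\<close> is odd, to the pair \<open>- x\<close>, \<open>- y\<close>.\<close>

lemma perturbed_trichotomy:
  assumes deriv: "\<And>t. t > 0 \<Longrightarrow> (y has_real_derivative - f (x t)) (at t)"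
    and y0: "(y \<longlongrightarrow> 0) at_top"
    and close: "((\<lambda>t. (x t - y t) / \<phi> t) \<longlongrightarrow> 0) at_top"
  shows "\<exists>l\<in>{-1, 0, 1}. ((\<lambda>t. y t / \<phi> t) \<longlongrightarrow> l) at_top"
proof -
  consider (pos) \<mu> where "0 < \<mu>" "\<mu> < 1" "frequently (\<lambda>t. \<mu> * \<phi> t \<le> y t) at_top"
    | (neg) \<mu> where "0 < \<mu>" "\<mu> < 1" "frequently (\<lambda>t. \<mu> * \<phi> t \<le> - y t) at_top"
    | (small) "\<And>\<mu>. 0 < \<mu> \<Longrightarrow> \<mu> < 1 \<Longrightarrow>
        eventually (\<lambda>t. y t < \<mu> * \<phi> t) at_top \<and> eventually (\<lambda>t. - y t < \<mu> * \<phi> t) at_top"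
    unfolding frequently_def by (metis (mono_tags, lifting) eventually_mono not_le)
  then show ?thesis
  proof cases
    case pos
    from tendsto_1_if_frequently_ge[OF deriv y0 close this] show ?thesis by blast
  next
    case neg
    have "((\<lambda>t. - y t / \<phi> t) \<longlongrightarrow> 1) at_top"
    proof (rule tendsto_1_if_frequently_ge[where x = "\<lambda>t. - x t", OF _ _ _ neg])
      show "((\<lambda>t. - y t) has_real_derivative - f (- x t)) (at t)" if "t > 0" for t
        using DERIV_minus[OF deriv[OF that]] by (simp add: odd)
      show "((\<lambda>t. - y t) \<longlongrightarrow> 0) at_top"
        using tendsto_minus[OF y0] by simp
      show "((\<lambda>t. (- x t - - y t) / \<phi> t) \<longlongrightarrow> 0) at_top"
        using tendsto_minus[OF close] by (simp add: minus_divide_left)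
    qed
    from tendsto_minus[OF this] show ?thesis by auto
  next
    case small
    have "((\<lambda>t. y t / \<phi> t) \<longlongrightarrow> 0) at_top"
    proof (rule tendstoI)
      fix e :: real assume "e > 0"
      define \<mu> where "\<mu> = min e 1 / 2"
      have \<mu>: "0 < \<mu>" "\<mu> < 1" "\<mu> < e" using \<open>e > 0\<close> by (auto simp: \<mu>_def)
      show "eventually (\<lambda>t. dist (y t / \<phi> t) 0 < e) at_top"
        using small[OF \<mu>(1,2), THEN conjunct1] small[OF \<mu>(1,2), THEN conjunct2]
          eventually_ge_at_top[of 0]
      proof eventually_elim
        case (elim t)
        have p: "\<phi> t > 0" using elim \<phi>_pos by simp
        have "\<bar>y t\<bar> < \<mu> * \<phi> t" using elim by linarith
        also have "\<dots> < e * \<phi> t" using p \<mu> by simp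
        finally show ?case using p by (simp add: field_simps)
      qed
    qed
    then show ?thesis by blast
  qed
qed

end

section \<open>From the limit hypotheses on \<open>f\<close> to eventual inequalities\<close>

lemma restoring_forceI:
  fixes f :: "real \<Rightarrow> real"
  assumes lip: "local_lipschitz (UNIV :: real set) UNIV (\<lambda>_. f)"
    and mono: "mono f"
    and odd: "\<And>y. f (- y) = - f y"
    and sign: "\<And>y. y \<noteq> 0 \<Longrightarrow> y * f y > 0"
    and Phi_lim: "(Phi_lower f \<longlongrightarrow> 1) (at_right 0)"
    and limsup: "\<And>\<mu>. 0 < \<mu> \<Longrightarrow> \<mu> < 1 \<Longrightarrow>
          Limsup (at_right 0) (\<lambda>y. ereal (f (\<mu> * y) / f y)) < ereal \<mu>"
  shows "restoring_force f"
proof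
  show pos: "f u > 0" if "u > 0" for u
    using sign[of u] that by (simp add: zero_less_mult_iff)
  have f0: "f 0 = 0"
    using odd[of 0] by simp
  have evpos: "eventually (\<lambda>u. f u > 0) (at_right 0)"
    using eventually_at_right_less[of 0] by eventually_elim (rule pos)
  show "continuous_on UNIV f"
    using local_lipschitz_continuous_on[OF lip, of 0] by simp
  show "\<exists>L>0. eventually (\<lambda>u. f u \<le> L * u) (at_right 0)"
  proof -
    obtain d L where d: "d > 0" and L: "\<And>s. s \<in> cball (0::real) d \<inter> UNIV \<Longrightarrow> L-lipschitz_on (cball 0 d \<inter> UNIV) f"
      by (rule local_lipschitzE[OF lip, of 0 0]) auto
    have L': "L-lipschitz_on (cball 0 d) f" using L[of 0] d by simp
    \<comment> \<open>The Lipschitz constant may be \<open>0\<close>; adding \<open>1\<close> makes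
      the slope positive.\<close>
    have "f u \<le> (L + 1) * u" if "0 < u" "u < d" for u
    proof -
      have "dist (f u) (f 0) \<le> L * dist u 0"
        using that d by (intro lipschitz_onD[OF L']) auto
      then have "f u \<le> L * u" using that f0 by simp
      then show ?thesis using that by (simp add: algebra_simps)
    qed
    then show ?thesis
      using d lipschitz_on_nonneg[OF L'] unfolding eventually_at_right_field
      by (intro exI[of _ "L + 1"]) auto
  qed
  show "\<exists>\<epsilon>. 0 < \<epsilon> \<and> \<epsilon> < 1 \<and> eventually (\<lambda>u. (1 - \<eta>) * f u \<le> f ((1 - \<epsilon>) * u)) (at_right 0)"
    if "\<eta> > 0" for \<eta>
  proof -
    have "eventually (\<lambda>\<epsilon>. ereal (1 - \<eta>) < Phi_lower f \<epsilon>) (at_right 0)"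
      by (rule order_tendstoD(1)[OF Phi_lim]) (use that in \<open>simp add: one_ereal_def\<close>)
    moreover have "eventually (\<lambda>\<epsilon>. 0 < \<epsilon> \<and> \<epsilon> < (1::real)) (at_right 0)"
      by (auto simp: eventually_at_right_field intro: exI[of _ 1])
    ultimately have "eventually (\<lambda>\<epsilon>. ereal (1 - \<eta>) < Phi_lower f \<epsilon> \<and> 0 < \<epsilon> \<and> \<epsilon> < 1) (at_right 0)"
      by eventually_elim auto
    then obtain \<epsilon> where \<epsilon>: "ereal (1 - \<eta>) < Phi_lower f \<epsilon>" "0 < \<epsilon>" "\<epsilon> < 1"
      using eventually_happens'[of "at_right (0::real)"] by force
    have "eventually (\<lambda>u. (1 - \<eta>) * f u \<le> f ((1 - \<epsilon>) * u)) (at_right 0)"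
      using less_LiminfD[OF \<epsilon>(1)[unfolded Phi_lower_def]] evpos
      by eventually_elim (simp add: field_simps)
    with \<epsilon> show ?thesis by blast
  qed
  show "\<exists>c<\<mu>. eventually (\<lambda>u. f (\<mu> * u) \<le> c * f u) (at_right 0)" if \<mu>: "0 < \<mu>" "\<mu> < 1" for \<mu>
  proof -
    \<comment> \<open>A real number strictly between the upper limit and \<open>\<mu>\<close> turns
      the strict inequality of limits into a gap uniform in small \<open>u\<close>.\<close>
    obtain c where c: "Limsup (at_right 0) (\<lambda>y. ereal (f (\<mu> * y) / f y)) < ereal c" "ereal c < ereal \<mu>"
      using ereal_dense2[OF limsup[OF \<mu>]] by blast
    have "eventually (\<lambda>u. f (\<mu> * u) \<le> c * f u) (at_right 0)"
      using Limsup_lessD[OF c(1)] evpos by eventually_elim (simp add: field_simps)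
    with c(2) show ?thesis by auto
  qed
qed (use mono odd in auto)

section \<open>Tail integrals and the equivalence\<close>

lemma integral_has_real_derivative_at:
  fixes g :: "real \<Rightarrow> real"
  assumes "continuous_on {a..} g" "t > a"
  shows "((\<lambda>t. integral {a..t} g) has_real_derivative g t) (at t)"
  using integral_has_real_derivative[of a "t + 1" g t] continuous_on_subset[OF assms(1), of "{a..t + 1}"] assms(2)
  by (auto simp: at_within_Icc_at)

text \<open>Convergence of the integral from \<open>0\<close> gives convergence of every tail, which
  is what makes the value of \<open>Lim\<close> meaningful.\<close>

lemma tail_integral_eq:
  assumes g: "continuous_on {0..} g" and I: "((\<lambda>t. integral {0..t} g) \<longlongrightarrow> I) at_top"
    and t: "t \<ge> 0"
  shows "tail_integral g t = I - integral {0..t} g"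
  unfolding tail_integral_def
proof (rule tendsto_Lim)
  have "((\<lambda>T. integral {0..T} g - integral {0..t} g) \<longlongrightarrow> I - integral {0..t} g) at_top"
    by (intro tendsto_intros I)
  moreover have "eventually (\<lambda>T. integral {0..T} g - integral {0..t} g = integral {t..T} g) at_top"
    using eventually_ge_at_top[of t]
  proof eventually_elim
    case (elim T)
    have "g integrable_on {0..T}"
      using g by (intro integrable_continuous_real) (auto intro: continuous_on_subset)
    from Henstock_Kurzweil_Integration.integral_combine[OF t elim this] show ?case by simp
  qed
  ultimately show "((\<lambda>T. integral {t..T} g) \<longlongrightarrow> I - integral {0..t} g) at_top"
    by (rule Lim_transform_eventually)
qed simp

theorem theorem1:
  fixes f g x :: "real \<Rightarrow> real" and \<xi> :: real
  assumes f_lipschitz: "local_lipschitz (UNIV :: real set) UNIV (\<lambda>_. f)"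
    and f_increasing: "mono f"
    and f_odd: "\<And>y. f (- y) = - f y"
    and f_zero: "f 0 = 0"
    and f_sign: "\<And>y. y \<noteq> 0 \<Longrightarrow> y * f y > 0"
    and Phi_pos: "\<exists>\<epsilon>0. 0 < \<epsilon>0 \<and> \<epsilon>0 < 1 \<and> (\<forall>\<epsilon>. 0 < \<epsilon> \<and> \<epsilon> < \<epsilon>0 \<longrightarrow> Phi_lower f \<epsilon> > 0)"
    and Phi_lim: "(Phi_lower f \<longlongrightarrow> 1) (at_right 0)"
    and f_limsup: "\<And>\<mu>. 0 < \<mu> \<Longrightarrow> \<mu> < 1 \<Longrightarrow>
          Limsup (at_right 0) (\<lambda>y. ereal (f (\<mu> * y) / f y)) < ereal \<mu>"
    and g_cont: "continuous_on {0..} g"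
    and x_cont: "continuous_on {0..} x"
    and x_init: "x 0 = \<xi>"
    and x_ode: "\<And>t. t > 0 \<Longrightarrow> (x has_real_derivative (- f (x t) + g t)) (at t)"
    and x_lim: "(x \<longlongrightarrow> 0) at_top"
  shows "((\<exists>I. ((\<lambda>t. integral {0..t} g) \<longlongrightarrow> I) at_top) \<and>
          ((\<lambda>t. tail_integral g t / F_inv f t) \<longlongrightarrow> 0) at_top)
     \<longleftrightarrow> (\<exists>l\<in>{- 1, 0, 1}. ((\<lambda>t. x t / F_inv f t) \<longlongrightarrow> l) at_top)"
proof -
  interpret restoring_force f
    by (rule restoring_forceI[OF f_lipschitz f_increasing f_odd f_sign Phi_lim f_limsup])
  define P where "P t = x t - integral {0..t} g" for t
  have P_deriv: "(P has_real_derivative - f (x t)) (at t)" if "t > 0" for t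
    unfolding P_def
    using DERIV_diff[OF x_ode[OF that] integral_has_real_derivative_at[OF g_cont that]] by simp
  show ?thesis
  proof
    assume "(\<exists>I. ((\<lambda>t. integral {0..t} g) \<longlongrightarrow> I) at_top) \<and>
          ((\<lambda>t. tail_integral g t / F_inv f t) \<longlongrightarrow> 0) at_top"
    then obtain I where I: "((\<lambda>t. integral {0..t} g) \<longlongrightarrow> I) at_top"
      and tail: "((\<lambda>t. tail_integral g t / \<phi> t) \<longlongrightarrow> 0) at_top" by blast
    \<comment> \<open>Adding \<open>I\<close> turns \<open>P t\<close> into
      \<open>x t + tail_integral g t\<close> for \<open>t \<ge> 0\<close>, which vanishes at
      infinity.\<close>
    define y where "y t = P t + I" for t
    have y_tail: "eventually (\<lambda>t. tail_integral g t = y t - x t) at_top"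
      using eventually_ge_at_top[of 0]
      by eventually_elim (simp add: tail_integral_eq[OF g_cont I] y_def P_def)
    have y_deriv: "(y has_real_derivative - f (x t)) (at t)" if "t > 0" for t
      unfolding y_def using P_deriv[OF that] by (auto intro!: derivative_eq_intros)
    have "((\<lambda>t. x t - integral {0..t} g + I) \<longlongrightarrow> 0 - I + I) at_top"
      by (intro tendsto_intros I x_lim)
    then have y0: "(y \<longlongrightarrow> 0) at_top" unfolding y_def P_def by simp
    have tail': "((\<lambda>t. (y t - x t) / \<phi> t) \<longlongrightarrow> 0) at_top"
      by (rule Lim_transform_eventually[OF tail]) (use y_tail in \<open>auto elim!: eventually_mono\<close>)
    have close: "((\<lambda>t. (x t - y t) / \<phi> t) \<longlongrightarrow> 0) at_top"
      using tendsto_minus[OF tail'] by (simp add: minus_divide_left)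
    obtain l where l: "l \<in> {-1, 0, 1}" "((\<lambda>t. y t / \<phi> t) \<longlongrightarrow> l) at_top"
      using perturbed_trichotomy[OF y_deriv y0 close] by blast
    have "((\<lambda>t. y t / \<phi> t + (x t - y t) / \<phi> t) \<longlongrightarrow> l + 0) at_top"
      by (intro tendsto_intros l close)
    then have "((\<lambda>t. x t / \<phi> t) \<longlongrightarrow> l) at_top"
      by (simp add: add_divide_distrib[symmetric])
    with l(1) show "\<exists>l\<in>{- 1, 0, 1}. ((\<lambda>t. x t / \<phi> t) \<longlongrightarrow> l) at_top" by blast
  next
    assume "\<exists>l\<in>{- 1, 0, 1}. ((\<lambda>t. x t / F_inv f t) \<longlongrightarrow> l) at_top"
    then obtain l where l: "l \<in> {-1, 0, 1}" and lim: "((\<lambda>t. x t / \<phi> t) \<longlongrightarrow> l) at_top" by blast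
    obtain p where p: "(P \<longlongrightarrow> p) at_top" and Pp: "((\<lambda>t. (P t - p) / \<phi> t) \<longlongrightarrow> l) at_top"
      using antiderivative_asymp[OF P_deriv f_ratio_\<phi>[OF l lim]] by blast
    have "((\<lambda>t. x t - P t) \<longlongrightarrow> 0 - p) at_top"
      by (intro tendsto_intros x_lim p)
    then have I: "((\<lambda>t. integral {0..t} g) \<longlongrightarrow> - p) at_top"
      by (simp add: P_def)
    \<comment> \<open>The tail integral equals \<open>(P t - p) - x t\<close>, so the two equal
      limits cancel.\<close>
    have "((\<lambda>t. (P t - p) / \<phi> t - x t / \<phi> t) \<longlongrightarrow> l - l) at_top"
      by (intro tendsto_intros Pp lim)
    moreover have "eventually (\<lambda>t. (P t - p) / \<phi> t - x t / \<phi> t = tail_integral g t / \<phi> t) at_top"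
      using eventually_ge_at_top[of 0]
      by eventually_elim (simp add: tail_integral_eq[OF g_cont I] P_def diff_divide_distrib)
    ultimately have "((\<lambda>t. tail_integral g t / \<phi> t) \<longlongrightarrow> l - l) at_top"
      by (rule Lim_transform_eventually)
    with I show "(\<exists>I. ((\<lambda>t. integral {0..t} g) \<longlongrightarrow> I) at_top) \<and>
          ((\<lambda>t. tail_integral g t / F_inv f t) \<longlongrightarrow> 0) at_top"
      by auto
  qed
qed

end
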